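(* Let $\mathbf{L}\in\mathbb{R}^{N\times N}$ be a (diagonalizable) variation operator of a graph $G$ on $N$ nodes, with eigenvector matrix $\mathbf{U}=[\mathbf{u}^1\cdots\mathbf{u}^N]$. Let $\Phi$ be the matrix whose columns are given by the smoothest signals $\phi_\infty^*$ obtained sequentially after each iteration of the greedy sampling set selection algorithm with $k=\infty$, i.e. $\Phi=\left[\phi^*_\infty|_{|\mathcal{S}|=0}\ \ \phi^*_\infty|_{|\mathcal{S}|=1}\ \cdots\right]$. Further, let $\mathbf{T}$ be the matrix obtained by performing column-wise Gaussian elimination on $\mathbf{U}$ with partial pivoting. Then the columns of $\mathbf{T}$ are equal to the columns of $\Phi$ within a scaling factor.
   Context: $G$ is a graph on nodes $\mathcal{V}=\{1,\dots,N\}$; a graph signal is a vector in $\mathbb{R}^N$. A variation operator $\mathbf{L}$ is a real $N\times N$ matrix associated with $G$ (not necessarily symmetric), assumed diagonalizable, with eigenvalues ordered so that $|\lambda_1|\le\dots\le|\lambda_N|$ and corresponding linearly independent eigenvectors $\mathbf{u}^1,\dots,\mathbf{u}^N$. The graph Fourier transform of $\mathbf{f}$ is $\tilde{\mathbf{f}}=\mathbf{U}^{-1}\mathbf{f}$, and the bandwidth of $\mathbf{f}\neq\mathbf{0}$ is $\omega(\mathbf{f})=\max\{|\lambda_i|:\tilde{\mathbf{f}}_i\neq 0\}$. For $\mathcal{A}\subseteq\mathcal{V}$, $L_2(\mathcal{A})$ is the set of $\mathbf{x}\in\mathbb{R}^N$ vanishing outside $\mathcal{A}$, and $\mathcal{S}^c=\mathcal{V}\setminus\mathcal{S}$.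 Greedy algorithm: start with $\mathcal{S}=\emptyset$; while $|\mathcal{S}|$ is less than the prescribed sampling set size, compute the smoothest signal $\phi_k^*\in L_2(\mathcal{S}^c)$, i.e. the minimizer over nonzero $\phi\in L_2(\mathcal{S}^c)$ of the spectral proxy $\omega_k(\phi)=(\|\mathbf{L}^k\phi\|/\|\phi\|)^{1/k}$; let $v=\operatorname{arg\,max}_i(\phi_k^*(i))^2$; and replace $\mathcal{S}$ by $\mathcal{S}\cup\{v\}$. For $k=\infty$, $\omega_k(\phi)$ is replaced by its limit $\lim_{k\to\infty}\omega_k(\phi)=\omega(\phi)$, so that $\phi_\infty^*$ is the signal of smallest bandwidth in $L_2(\mathcal{S}^c)$. The signal computed when $|\mathcal{S}|=i$ is denoted $\phi^*_\infty|_{|\mathcal{S}|=i}$ and is the $(i+1)$-th column of $\Phi$. Column-wise Gaussian elimination with partial pivoting on $\mathbf{U}$: the columns $\mathbf{t}^1,\mathbf{t}^2,\dots$ of $\mathbf{T}$ are produced sequentially; $\mathbf{t}^1=\mathbf{u}^1$, and $\mathbf{t}^{i+1}$ is obtained from $\mathbf{u}^{i+1}$ by subtracting a linear combination of $\mathbf{t}^1,\dots,\mathbf{t}^i$ so that the entries in the previously selected pivot rows $p_1,\dots,p_i$ become zero; the pivot row $p_{i+1}$ is the index of the entry of $\mathbf{t}^{i+1}$ of maximum magnitude (rows are not physically permuted).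
   Formalization: With tied |λ_i| the smoothest signal is not unique and the claim can fail (L=diag(1,-1)). Proved: column j agrees for every greedy run if |λ_i|<|λ_i'| for all i≤j, i'>i; and for real U, ties allowed, some choice of smoothest signals makes all columns agree. Arg max ties are broken alike. *)

theory Defs
  imports "HOL-Analysis.Analysis"
begin

text \<open>
  The nodes form a finite linearly ordered type (think of \<open>{1..N}\<close>).  The same type indexes the
  columns of the matrices below, so the columns left of column \<open>j\<close> are those in \<open>{..<j}\<close> and
  \<open>j\<close> is column number \<open>card {..<j} + 1\<close>.  Signals and the operator are real; its spectrum and
  eigenvectors may be complex, because the operator need not be symmetric.
\<close>

definition cvec :: "real^'n \<Rightarrow> complex^'n" where
  "cvec f = (\<chi> i. complex_of_real (f $ i))"

definition eigendecomposition ::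
    "real^'n::{finite,linorder}^'n::{finite,linorder} \<Rightarrow> ('n \<Rightarrow> complex) \<Rightarrow>
     complex^'n::{finite,linorder}^'n::{finite,linorder} \<Rightarrow> bool" where
  "eigendecomposition L lam U \<longleftrightarrow>
     mono (\<lambda>j. norm (lam j)) \<and>
     invertible U \<and>
     (\<forall>j. map_matrix complex_of_real L *v column j U = lam j *s column j U)"

definition gft :: "complex^'n^'n \<Rightarrow> real^'n \<Rightarrow> complex^'n" where
  "gft U f = matrix_inv U *v cvec f"

definition bandwidth :: "('n \<Rightarrow> complex) \<Rightarrow> complex^'n^'n \<Rightarrow> real^'n \<Rightarrow> real" where
  "bandwidth lam U f = Max {norm (lam i) | i. gft U f $ i \<noteq> 0}"

text \<open>
  Powers of \<open>L\<close> are iterates of \<open>(*v) L\<close>: the power operation on the type of matrices is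
  componentwise.
\<close>
definition spectral_proxy :: "real^'n^'n \<Rightarrow> nat \<Rightarrow> real^'n \<Rightarrow> real" where
  "spectral_proxy L k f = root k (norm ((((*v) L) ^^ k) f) / norm f)"

text \<open>The limit exists, and equals the bandwidth, by \<open>spectral_proxy_inf_eq_bandwidth\<close> below.\<close>
definition spectral_proxy_inf :: "real^'n^'n \<Rightarrow> real^'n \<Rightarrow> real" where
  "spectral_proxy_inf L f = lim (\<lambda>k. spectral_proxy L k f)"

definition L2 :: "'n set \<Rightarrow> (real^'n) set" where
  "L2 A = {f. \<forall>i. i \<notin> A \<longrightarrow> f $ i = 0}"

text \<open>
  The minimizer is unique up to scaling only while the moduli of the eigenvalues are distinct; with
  ties (for instance a conjugate pair) it can be any signal from a space of dimension at least 2.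
\<close>
definition smoothest_signal :: "real^'n^'n \<Rightarrow> 'n set \<Rightarrow> real^'n \<Rightarrow> bool" where
  "smoothest_signal L A = is_arg_min (spectral_proxy_inf L) (\<lambda>f. f \<in> L2 A \<and> f \<noteq> 0)"

text \<open>
  Both algorithms take an index of maximal magnitude.  Ties are resolved by a rule \<open>sel\<close> that picks
  an element of the set of maximizers.  Being a function of that set only, it treats
  vectors that are multiples of each other alike.
\<close>
definition tie_breaking :: "('n set \<Rightarrow> 'n) \<Rightarrow> bool" where
  "tie_breaking sel \<longleftrightarrow> (\<forall>A. A \<noteq> {} \<longrightarrow> sel A \<in> A)"

definition argmax_by :: "('n set \<Rightarrow> 'n) \<Rightarrow> ('n \<Rightarrow> real) \<Rightarrow> 'n" where
  "argmax_by sel g = sel {i. is_arg_max g (\<lambda>_. True) i}"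

text \<open>
  A run of the greedy algorithm up to sampling set size \<open>M\<close>: column \<open>j\<close> of \<open>\<Phi>\<close> is the signal
  computed, and \<open>v j\<close> the node added, when the sampling set is \<open>S = v ` {..<j}\<close>, which has
  \<open>card {..<j}\<close> elements.
\<close>
definition greedy_run ::
    "('n set \<Rightarrow> 'n) \<Rightarrow> real^'n::{finite,linorder}^'n::{finite,linorder} \<Rightarrow> nat \<Rightarrow>
     real^'n::{finite,linorder}^'n::{finite,linorder} \<Rightarrow> ('n \<Rightarrow> 'n) \<Rightarrow> bool" where
  "greedy_run sel L M \<Phi> v \<longleftrightarrow>
     (\<forall>j. card {..<j} < M \<longrightarrow>
        smoothest_signal L (- (v ` {..<j})) (column j \<Phi>) \<and>
        v j = argmax_by sel (\<lambda>i. (column j \<Phi> $ i)\<^sup>2))"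

text \<open>
  \<open>T\<close> results from column-wise Gaussian elimination on \<open>U\<close> with partial pivoting; \<open>p j\<close> is the
  pivot row of column \<open>j\<close>.
\<close>
definition gauss_elimination ::
    "('n set \<Rightarrow> 'n) \<Rightarrow> complex^'n::{finite,linorder}^'n::{finite,linorder} \<Rightarrow>
     complex^'n::{finite,linorder}^'n::{finite,linorder} \<Rightarrow> ('n \<Rightarrow> 'n) \<Rightarrow> bool" where
  "gauss_elimination sel U T p \<longleftrightarrow>
     (\<forall>j. (\<exists>a. column j T = column j U - (\<Sum>i\<in>{..<j}. a i *s column i T)) \<and>
          (\<forall>i<j. column j T $ p i = 0) \<and>
          p j = argmax_by sel (\<lambda>r. norm (column j T $ r)))"

lemma norm_cvec: "norm (cvec f) = norm f"
  by (simp add: norm_vec_def cvec_def)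

lemma cvec_mult: "cvec (L *v f) = map_matrix complex_of_real L *v cvec f"
  by (simp add: cvec_def matrix_vector_mult_def vec_eq_iff)

lemma invertible_matrix_inv:
  assumes "invertible U"
  shows "U ** matrix_inv U = mat 1" "matrix_inv U ** U = mat 1"
  using someI_ex[OF assms[unfolded invertible_def]] by (simp_all add: matrix_inv_def)

lemma cvec_eq_mult_gft:
  assumes "invertible U"
  shows "cvec f = U *v gft U f"
  using assms
  by (simp add: gft_def matrix_vector_mul_assoc invertible_matrix_inv)

lemma eigendecomposition_power:
  fixes L :: "real^'n::{finite,linorder}^'n::{finite,linorder}"
  assumes "eigendecomposition L lam U"
  shows "cvec ((((*v) L) ^^ k) f) = U *v (\<chi> i. lam i ^ k * gft U f $ i)"
proof (induction k)
  case 0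
  have "(\<chi> i. gft U f $ i) = gft U f"
    by (simp add: vec_eq_iff)
  then show ?case
    using assms cvec_eq_mult_gft[of U f] by (simp add: eigendecomposition_def)
next
  case (Suc k)
  let ?C = "map_matrix complex_of_real L"
  have sum: "U *v w = (\<Sum>i\<in>UNIV. w $ i *s column i U)" for w
    by (rule matrix_mult_sum)
  have scal: "?C *v (c *s x) = c *s (?C *v x)" for c x
    by (simp add: vec.scale)
  have "cvec ((((*v) L) ^^ Suc k) f) = ?C *v (U *v (\<chi> i. lam i ^ k * gft U f $ i))"
    by (simp add: cvec_mult Suc)
  also have "\<dots> = (\<Sum>i\<in>UNIV. (lam i ^ k * gft U f $ i) *s (?C *v column i U))"
    unfolding sum by (simp add: vec.sum scal)
  also have "\<dots> = (\<Sum>i\<in>UNIV. (lam i ^ Suc k * gft U f $ i) *s column i U)"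
    using assms by (simp add: eigendecomposition_def vector_smult_assoc mult_ac)
  also have "\<dots> = U *v (\<chi> i. lam i ^ Suc k * gft U f $ i)"
    unfolding sum by simp
  finally show ?case .
qed

theorem spectral_proxy_tendsto_bandwidth:
  fixes L :: "real^'n::{finite,linorder}^'n::{finite,linorder}"
  assumes eig: "eigendecomposition L lam U" and f: "f \<noteq> 0"
  shows "(\<lambda>k. spectral_proxy L k f) \<longlonglongrightarrow> bandwidth lam U f"
proof -
  let ?c = "gft U f" and ?S = "{norm (lam i) | i. gft U f $ i \<noteq> 0}" and ?b = "bandwidth lam U f"
  define w where "w k = (\<chi> i. lam i ^ k * ?c $ i)" for k
  have inv: "invertible U"
    using eig by (simp add: eigendecomposition_def)
  have fin: "finite ?S"
    by simp
  have nz: "?c \<noteq> 0"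
  proof
    assume "?c = 0"
    then have "norm (cvec f) = 0"
      using cvec_eq_mult_gft[OF inv, of f] by simp
    then show False
      using f by (simp add: norm_cvec)
  qed
  then have ne: "?S \<noteq> {}"
    by (auto simp: vec_eq_iff)
  from Max_in[OF fin ne] obtain m where m: "?b = norm (lam m)" "?c $ m \<noteq> 0"
    by (auto simp: bandwidth_def)
  have le: "norm (lam i) \<le> ?b" if "?c $ i \<noteq> 0" for i
    unfolding bandwidth_def using that fin by (intro Max_ge) auto
  have b0: "?b \<ge> 0"
    using m by simp
  obtain A where A: "A > 0" "\<And>x. norm (U *v x) \<le> norm x * A"
    using bounded_linear.pos_bounded[OF matrix_vector_mul_bounded_linear[of U]] by blast
  obtain B where B: "B > 0" "\<And>x. norm (matrix_inv U *v x) \<le> norm x * B"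
    using bounded_linear.pos_bounded[OF matrix_vector_mul_bounded_linear[of "matrix_inv U"]] by blast
  have up: "norm (w k) \<le> ?b ^ k * norm ?c" for k
  proof -
    have "norm (w k) \<le> norm ((?b ^ k) *\<^sub>R ?c)"
    proof (rule norm_le_componentwise_cart)
      fix i
      show "norm (w k $ i) \<le> norm (((?b ^ k) *\<^sub>R ?c) $ i)"
        using le[of i] b0
        by (cases "?c $ i = 0")
           (auto simp: w_def norm_mult norm_power intro!: mult_right_mono power_mono)
    qed
    then show ?thesis
      using b0 by simp
  qed
  have lo: "?b ^ k * norm (?c $ m) \<le> norm (w k)" for k
    using Finite_Cartesian_Product.norm_nth_le[of "w k" m] m by (simp add: w_def norm_mult norm_power)
  have nf: "norm f > 0"
    using f by simp
  have nrm: "norm ((((*v) L) ^^ k) f) = norm (U *v w k)" for k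
    using eigendecomposition_power[OF eig, of k f] norm_cvec[of "(((*v) L) ^^ k) f"]
    by (simp add: w_def)
  define a1 where "a1 = norm (?c $ m) / (B * norm f)"
  define a2 where "a2 = norm ?c * A / norm f"
  have pos: "a1 > 0" "a2 > 0"
    using m nz A B nf by (auto simp: a1_def a2_def)
  have L2: "norm ((((*v) L) ^^ k) f) / norm f \<le> a2 * ?b ^ k" for k
  proof -
    have "norm (U *v w k) \<le> (?b ^ k * norm ?c) * A"
      by (rule order_trans[OF A(2) mult_right_mono[OF up]]) (use A in auto)
    then show ?thesis
      using nf by (simp add: nrm a2_def divide_simps mult_ac)
  qed
  have L1: "a1 * ?b ^ k \<le> norm ((((*v) L) ^^ k) f) / norm f" for k
  proof -
    have "w k = matrix_inv U *v (U *v w k)"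
      using inv by (simp add: matrix_vector_mul_assoc invertible_matrix_inv)
    then have "norm (w k) \<le> norm (U *v w k) * B"
      using B(2)[of "U *v w k"] by simp
    then have "?b ^ k * norm (?c $ m) \<le> norm (U *v w k) * B"
      using lo[of k] by linarith
    then show ?thesis
      using nf B by (simp add: nrm a1_def divide_simps mult_ac)
  qed
  have rt: "root k (a * ?b ^ k) = root k a * ?b" if "k > 0" for k a
    using that b0 by (simp add: real_root_mult real_root_power_cancel)
  have lim: "(\<lambda>k. root k a * ?b) \<longlonglongrightarrow> ?b" if "a > 0" for a
    using tendsto_mult_right[OF LIMSEQ_root_const[OF that], of ?b] by simp
  show ?thesis
  proof (rule tendsto_sandwich[OF _ _ lim[OF pos(1)] lim[OF pos(2)]])
    show "\<forall>\<^sub>F k in sequentially. root k a1 * ?b \<le> spectral_proxy L k f"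
      using eventually_gt_at_top[of 0]
      by eventually_elim (use L1 in \<open>simp add: rt[symmetric] spectral_proxy_def\<close>)
    show "\<forall>\<^sub>F k in sequentially. spectral_proxy L k f \<le> root k a2 * ?b"
      using eventually_gt_at_top[of 0]
      by eventually_elim (use L2 in \<open>simp add: rt[symmetric] spectral_proxy_def\<close>)
  qed
qed

corollary spectral_proxy_inf_eq_bandwidth:
  fixes L :: "real^'n::{finite,linorder}^'n::{finite,linorder}"
  assumes "eigendecomposition L lam U" and "f \<noteq> 0"
  shows "spectral_proxy_inf L f = bandwidth lam U f"
  unfolding spectral_proxy_inf_def
  by (rule limI[OF spectral_proxy_tendsto_bandwidth[OF assms]])

end

theory Submission
  imports Defs
begin

text \<open>
  Column \<open>j\<close> of \<open>T\<close> is, up to scaling, the only combination of the first \<open>j\<close> columns of \<open>U\<close> that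
  vanishes on the earlier pivot rows.  Hence no nonzero signal vanishing there has bandwidth below
  \<open>norm (lam j)\<close>, and a signal of exactly this bandwidth is a multiple of column \<open>j\<close> when
  \<open>norm (lam j)\<close> is simple.  For this value to be attained by a real signal, the column must be a
  multiple of a real one, which holds because complex conjugation scales each of the first \<open>j\<close>
  columns of \<open>U\<close>: conjugation maps eigenvectors of the real matrix \<open>L\<close> to eigenvectors and
  preserves the modulus of the eigenvalue.
\<close>

lemma argmax_by_maximal:
  fixes g :: "'n::finite \<Rightarrow> real"
  assumes "tie_breaking sel"
  shows "g i \<le> g (argmax_by sel g)"
proof -
  have sel: "sel A \<in> A" if "A \<noteq> {}" for A
    using assms that by (simp add: tie_breaking_def)
  have "Max (range g) \<in> range g"
    by (intro Max_in) auto
  then obtain m where "Max (range g) = g m"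
    by blast
  then have "g i \<le> g m" for i
    using Max_ge[of "range g" "g i"] by simp
  then have "is_arg_max g (\<lambda>_. True) m"
    by (simp add: is_arg_max_def not_less)
  then have "{i. is_arg_max g (\<lambda>_. True) i} \<noteq> {}"
    by blast
  then have "argmax_by sel g \<in> {i. is_arg_max g (\<lambda>_. True) i}"
    unfolding argmax_by_def by (rule sel)
  then show ?thesis
    by (simp add: is_arg_max_def not_less)
qed

lemma argmax_by_cong:
  assumes "\<And>i k. g i < g k \<longleftrightarrow> h i < h k"
  shows "argmax_by sel g = argmax_by sel h"
  using assms by (simp add: argmax_by_def is_arg_max_def)

lemma argmax_by_scaled_cvec:
  assumes "x = c *s cvec f" and "c \<noteq> 0"
  shows "argmax_by sel (\<lambda>r. (f $ r)\<^sup>2) = argmax_by sel (\<lambda>r. norm (x $ r))"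
proof (rule argmax_by_cong)
  fix i k
  show "(f $ i)\<^sup>2 < (f $ k)\<^sup>2 \<longleftrightarrow> norm (x $ i) < norm (x $ k)"
    using assms by (simp add: cvec_def norm_mult abs_le_square_iff flip: not_le)
qed

lemma finite_linorder_less_induct:
  fixes j :: "'n::{finite,linorder}"
  assumes "\<And>j. (\<And>i. i < j \<Longrightarrow> P i) \<Longrightarrow> P j"
  shows "P j"
proof (induction j rule: measure_induct_rule[where f = "\<lambda>j. card {..<j}"])
  case (less j)
  have "card {..<i} < card {..<j}" if "i < j" for i
    using that by (intro psubset_card_mono) (auto simp: psubset_eq)
  then show ?case
    using assms less by blast
qed

lemma invertible_mult_eq_0_iff:
  fixes U :: "complex^'n^'n"
  assumes "invertible U"
  shows "U *v y = 0 \<longleftrightarrow> y = 0"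
proof
  assume "U *v y = 0"
  then have "matrix_inv U *v (U *v y) = 0"
    by simp
  then show "y = 0"
    using assms by (simp only: matrix_vector_mul_assoc invertible_matrix_inv matrix_vector_mul_lid)
qed simp

lemma mult_axis_eq_column:
  fixes U :: "complex^'n^'m"
  shows "U *v axis k 1 = column k U"
  by (simp add: matrix_vector_mult_def column_def axis_def vec_eq_iff if_distrib cong: if_cong)

lemma gft_mult:
  assumes "invertible U" and "cvec f = U *v y"
  shows "gft U f = y"
  using assms by (simp add: gft_def matrix_vector_mul_assoc invertible_matrix_inv)

lemma cvec_eq_0_iff: "cvec f = 0 \<longleftrightarrow> f = 0"
  using norm_cvec[of f] by (metis norm_eq_zero)

lemma gft_nonzero:
  assumes "invertible U" and "f \<noteq> 0"
  obtains i where "gft U f $ i \<noteq> 0"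
proof -
  have "gft U f \<noteq> 0"
    using assms cvec_eq_mult_gft[of U f] by (auto simp: cvec_eq_0_iff)
  then show ?thesis
    using that by (auto simp: vec_eq_iff)
qed

lemma bandwidth_le_iff:
  fixes U :: "complex^'n^'n"
  assumes "invertible U" and "f \<noteq> 0"
  shows "bandwidth lam U f \<le> b \<longleftrightarrow> (\<forall>i. gft U f $ i \<noteq> 0 \<longrightarrow> norm (lam i) \<le> b)"
proof -
  have "{norm (lam i) | i. gft U f $ i \<noteq> 0} \<noteq> {}"
    using gft_nonzero[OF assms] by blast
  then show ?thesis
    unfolding bandwidth_def by (subst Max_le_iff) auto
qed

subsection \<open>Gaussian elimination\<close>

context
  fixes U T :: "complex^'n::{finite,linorder}^'n::{finite,linorder}"
    and p :: "'n \<Rightarrow> 'n" and sel :: "'n set \<Rightarrow> 'n"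
  assumes inv: "invertible U"
    and sel: "tie_breaking sel"
    and gauss: "gauss_elimination sel U T p"
begin

lemma elimination_column_expansion:
  obtains y where "y $ j = 1" "\<And>k. k > j \<Longrightarrow> y $ k = 0" "column j T = U *v y"
proof -
  have "\<exists>y. y $ j = 1 \<and> (\<forall>k>j. y $ k = 0) \<and> column j T = U *v y"
  proof (induction j rule: finite_linorder_less_induct)
    case (1 j)
    then obtain Y where Y: "\<And>i. i < j \<Longrightarrow>
        Y i $ i = 1 \<and> (\<forall>k>i. Y i $ k = 0) \<and> column i T = U *v Y i"
      by metis
    obtain a where a: "column j T = column j U - (\<Sum>i\<in>{..<j}. a i *s column i T)"
      using gauss unfolding gauss_elimination_def by blast
    define y where "y = axis j 1 - (\<Sum>i\<in>{..<j}. a i *s Y i)"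
    have "(\<Sum>i\<in>{..<j}. a i *s Y i) $ k = 0" if "k \<ge> j" for k
      using Y that by (auto simp: sum_component intro!: sum.neutral)
    then have "y $ j = 1" "\<forall>k>j. y $ k = 0"
      by (simp_all add: y_def axis_def)
    moreover have "(\<Sum>i\<in>{..<j}. U *v (a i *s Y i)) = (\<Sum>i\<in>{..<j}. a i *s column i T)"
      using Y by (intro sum.cong) (auto simp: vec.scale)
    then have "U *v y = column j T"
      by (simp only: a y_def matrix_vector_mult_diff_distrib mult_axis_eq_column vec.sum)
    ultimately show ?case
      by metis
  qed
  then show ?thesis
    using that by blast
qed

lemma elimination_pivot:
  shows "i < j \<Longrightarrow> column j T $ p i = 0" and "column j T $ p j \<noteq> 0"
proof -
  show "column j T $ p i = 0" if "i < j"
    using gauss that unfolding gauss_elimination_def by blast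
  obtain y where "y $ j = 1" and y: "column j T = U *v y"
    using elimination_column_expansion[of j] by metis
  then have "y \<noteq> 0"
    by auto
  then have "column j T \<noteq> 0"
    by (simp add: y invertible_mult_eq_0_iff[OF inv])
  then obtain r where "column j T $ r \<noteq> 0"
    by (auto simp: vec_eq_iff)
  moreover have "norm (column j T $ r) \<le> norm (column j T $ p j)"
    using argmax_by_maximal[OF sel, of "\<lambda>r. norm (column j T $ r)" r] gauss
    unfolding gauss_elimination_def by metis
  ultimately show "column j T $ p j \<noteq> 0"
    by auto
qed

lemma elimination_column_unique:
  assumes "\<And>k. k > j \<Longrightarrow> y $ k = 0" and "\<And>i. i < j \<Longrightarrow> (U *v y) $ p i = 0"
  shows "U *v y = y $ j *s column j T"
  using assms
proof (induction j arbitrary: y rule: finite_linorder_less_induct)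
  case (1 j)
  obtain t where t: "t $ j = 1" "\<And>k. k > j \<Longrightarrow> t $ k = 0" "column j T = U *v t"
    using elimination_column_expansion[of j] by metis
  define z where "z = y - y $ j *s t"
  have Uz: "U *v z = U *v y - y $ j *s column j T"
    by (simp add: z_def t(3) matrix_vector_mult_diff_distrib vec.scale)
  have z0: "z $ k = 0" if "k \<ge> j" for k
    using that 1(2) t by (cases "k = j") (auto simp: z_def)
  have Uz0: "(U *v z) $ p i = 0" if "i < j" for i
    using that 1(3) elimination_pivot(1) by (simp add: Uz)
  have "z = 0"
  proof (rule ccontr)
    assume "z \<noteq> 0"
    then have ne: "{k. z $ k \<noteq> 0} \<noteq> {}"
      by (auto simp: vec_eq_iff)
    define m where "m = Max {k. z $ k \<noteq> 0}"
    have m: "z $ m \<noteq> 0"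
      using Max_in[OF _ ne] unfolding m_def by simp
    have m0: "z $ k = 0" if "k > m" for k
    proof (rule ccontr)
      assume "z $ k \<noteq> 0"
      then have "k \<le> m"
        unfolding m_def by (intro Max_ge) auto
      then show False
        using that by simp
    qed
    have "m < j"
      using m z0 not_le by blast
    then have "U *v z = z $ m *s column m T"
      using m0 Uz0 by (intro 1(1)) auto
    then have "(U *v z) $ p m \<noteq> 0"
      using m elimination_pivot(2) by simp
    then show False
      using Uz0 \<open>m < j\<close> by simp
  qed
  then show ?case
    using Uz by simp
qed

lemma elimination_column_real_multiple:
  assumes cnj: "\<And>k. k \<le> j \<Longrightarrow> \<exists>c. (\<chi> r. cnj (U $ r $ k)) = c *s column k U"
  shows "\<exists>c g. c \<noteq> 0 \<and> column j T = c *s cvec g"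
proof -
  let ?t = "column j T"
  obtain y where y: "y $ j = 1" "\<And>k. k > j \<Longrightarrow> y $ k = 0" "?t = U *v y"
    using elimination_column_expansion[of j] by metis
  obtain s where s: "\<And>k. k \<le> j \<Longrightarrow> (\<chi> r. cnj (U $ r $ k)) = s k *s column k U"
    using cnj by metis
  have s': "cnj (U $ r $ k) = s k * U $ r $ k" if "k \<le> j" for r k
    using s[OF that] by (simp add: vec_eq_iff column_def)
  define z where "z = (\<chi> k. s k * cnj (y $ k))"
  have "cnj (U $ r $ k * y $ k) = U $ r $ k * z $ k" for r k
    using s'[of k r] y(2)[of k] by (cases "k \<le> j") (auto simp: z_def)
  then have tz: "cnj (?t $ r) = (U *v z) $ r" for r
    by (simp add: y(3) matrix_vector_mult_def)
  have "U *v z = z $ j *s ?t"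
  proof (rule elimination_column_unique)
    show "z $ k = 0" if "k > j" for k
      using y(2)[OF that] by (simp add: z_def)
    show "(U *v z) $ p i = 0" if "i < j" for i
      using elimination_pivot(1)[OF that] by (simp flip: tz)
  qed
  then have c: "cnj (?t $ r) = z $ j * ?t $ r" for r
    by (simp add: tz)
  have Re: "complex_of_real (Re (?t $ r)) = (1 + z $ j) / 2 * ?t $ r" for r
    using complex_add_cnj[of "?t $ r"] c[of r] by (simp add: algebra_simps)
  have Im: "complex_of_real (Im (?t $ r)) = (1 - z $ j) / (2 * \<i>) * ?t $ r" for r
    using complex_diff_cnj[of "?t $ r"] c[of r] by (simp add: field_simps)
  show ?thesis
  proof (cases "1 + z $ j = 0")
    case True
    then have "1 - z $ j \<noteq> 0"
      by (metis add.right_neutral add_diff_cancel_left' diff_add_cancel one_neq_zero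
          add_eq_0_iff eq_iff_diff_eq_0 one_neq_neg_one)
    then show ?thesis
      by (intro exI[of _ "2 * \<i> / (1 - z $ j)"] exI[of _ "\<chi> r. Im (?t $ r)"])
         (simp_all add: vec_eq_iff cvec_def Im)
  next
    case False
    then show ?thesis
      by (intro exI[of _ "2 / (1 + z $ j)"] exI[of _ "\<chi> r. Re (?t $ r)"])
         (simp_all add: vec_eq_iff cvec_def Re)
  qed
qed

lemma bandwidth_ge_elimination:
  assumes mono: "mono (\<lambda>j. norm (lam j))"
    and f: "f \<in> L2 (- (p ` {..<j}))" "f \<noteq> 0"
  shows "norm (lam j) \<le> bandwidth lam U f"
proof (rule ccontr)
  assume "\<not> norm (lam j) \<le> bandwidth lam U f"
  then have *: "norm (lam k) < norm (lam j)" if "gft U f $ k \<noteq> 0" for k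
    using bandwidth_le_iff[OF inv f(2), of lam "bandwidth lam U f"] that by fastforce
  have z: "gft U f $ k = 0" if "k \<ge> j" for k
    using *[of k] monoD[OF mono that] by linarith
  have "U *v gft U f = gft U f $ j *s column j T"
  proof (rule elimination_column_unique)
    show "(U *v gft U f) $ p i = 0" if "i < j" for i
      using f(1) that unfolding cvec_eq_mult_gft[OF inv, symmetric] by (simp add: cvec_def L2_def)
  qed (simp add: z)
  then have "cvec f = 0"
    by (simp add: z flip: cvec_eq_mult_gft[OF inv])
  then show False
    using f(2) by (simp add: cvec_eq_0_iff)
qed

lemma elimination_column_signal:
  assumes mono: "mono (\<lambda>j. norm (lam j))" and c: "c \<noteq> 0" "column j T = c *s cvec g"
  shows "g \<in> L2 (- (p ` {..<j}))" "g \<noteq> 0" "bandwidth lam U g = norm (lam j)"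
proof -
  show L2: "g \<in> L2 (- (p ` {..<j}))"
  proof -
    have "c * complex_of_real (g $ p i) = 0" if "i < j" for i
      using elimination_pivot(1)[OF that] by (simp add: c(2) cvec_def)
    then show ?thesis
      using c(1) by (auto simp: L2_def)
  qed
  show nz: "g \<noteq> 0"
    using elimination_pivot(2)[of j] c by (auto simp: cvec_def)
  obtain y where y: "y $ j = 1" "\<And>k. k > j \<Longrightarrow> y $ k = 0" "column j T = U *v y"
    using elimination_column_expansion[of j] by metis
  have "cvec g = U *v (inverse c *s y)"
    using c by (simp add: vec.scale vector_smult_assoc flip: y(3))
  then have "gft U g = inverse c *s y"
    by (rule gft_mult[OF inv])
  then have "bandwidth lam U g \<le> norm (lam j)"
    using y(2) monoD[OF mono] by (auto simp: bandwidth_le_iff[OF inv nz]) (meson not_le)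
  then show "bandwidth lam U g = norm (lam j)"
    using bandwidth_ge_elimination[OF mono L2 nz] by simp
qed

end

subsection \<open>Smoothest signals\<close>

lemma smoothest_signal_iff:
  assumes "eigendecomposition L lam U"
  shows "smoothest_signal L A f \<longleftrightarrow>
    f \<in> L2 A \<and> f \<noteq> 0 \<and> (\<forall>g\<in>L2 A. g \<noteq> 0 \<longrightarrow> bandwidth lam U f \<le> bandwidth lam U g)"
  using spectral_proxy_inf_eq_bandwidth[OF assms]
  by (auto simp: smoothest_signal_def is_arg_min_linorder)

lemma cnj_eigenvector_simple_modulus:
  assumes eig: "eigendecomposition L lam U"
    and simple: "\<And>i. i \<noteq> k \<Longrightarrow> norm (lam i) \<noteq> norm (lam k)"
  shows "\<exists>c. (\<chi> r. cnj (U $ r $ k)) = c *s column k U"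
proof -
  let ?C = "map_matrix complex_of_real L"
  let ?x = "\<chi> r. cnj (U $ r $ k)"
  have inv: "invertible U" and ev: "\<And>j. ?C *v column j U = lam j *s column j U"
    using eig by (auto simp: eigendecomposition_def)
  define w where "w = matrix_inv U *v ?x"
  have Uw: "U *v w = ?x"
    using inv by (simp add: w_def matrix_vector_mul_assoc invertible_matrix_inv)
  have "(?C *v ?x) $ r = cnj ((?C *v column k U) $ r)" for r
    by (simp add: matrix_vector_mult_def column_def)
  then have Cx: "?C *v ?x = cnj (lam k) *s ?x"
    unfolding ev by (simp add: vec_eq_iff column_def)
  have "?C *v (U *v w) = (\<Sum>i\<in>UNIV. w $ i *s (?C *v column i U))"
    unfolding matrix_mult_sum[of U] by (simp add: vec.sum vec.scale)
  also have "\<dots> = U *v (\<chi> i. lam i * w $ i)"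
    unfolding matrix_mult_sum[of U] ev by (simp add: vector_smult_assoc mult.commute)
  finally have "U *v ((\<chi> i. lam i * w $ i) - cnj (lam k) *s w) = 0"
    using Cx by (simp add: Uw matrix_vector_mult_diff_distrib vec.scale)
  then have "(\<chi> i. lam i * w $ i) = cnj (lam k) *s w"
    using invertible_mult_eq_0_iff[OF inv] by fastforce
  then have "lam i * w $ i = cnj (lam k) * w $ i" for i
    by (simp add: vec_eq_iff)
  then have "w $ i = 0" if "i \<noteq> k" for i
    using simple[OF that] by (metis complex_mod_cnj mult_right_cancel)
  then have "w = w $ k *s axis k 1"
    by (simp add: vec_eq_iff axis_def)
  then have "?x = w $ k *s column k U"
    by (metis Uw mult_axis_eq_column vec.scale)
  then show ?thesis ..
qed

theorem proposition4:
  fixes L :: "real^'n::{finite,linorder}^'n::{finite,linorder}"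
    and lam :: "'n \<Rightarrow> complex"
    and U T :: "complex^'n::{finite,linorder}^'n::{finite,linorder}"
    and p :: "'n \<Rightarrow> 'n"
    and sel :: "'n set \<Rightarrow> 'n"
    and M :: nat
  assumes "eigendecomposition L lam U"
    and "tie_breaking sel"
    and "gauss_elimination sel U T p"
  shows
    "(\<forall>\<Phi> v. greedy_run sel L M \<Phi> v \<longrightarrow>
        (\<forall>j. card {..<j} < M \<and> (\<forall>i\<le>j. \<forall>i'>i. norm (lam i) < norm (lam i')) \<longrightarrow>
           (\<exists>c. c \<noteq> 0 \<and> column j T = c *s cvec (column j \<Phi>)))) \<and>
     ((\<forall>i j. U $ i $ j \<in> \<real>) \<longrightarrow>
        (\<exists>\<Phi> v. greedy_run sel L M \<Phi> v \<and>
           (\<forall>j. card {..<j} < M \<longrightarrow>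
              (\<exists>c. c \<noteq> 0 \<and> column j T = c *s cvec (column j \<Phi>)))))"
proof (intro conjI allI impI)
  have inv: "invertible U" and mono: "mono (\<lambda>j. norm (lam j))"
    using assms(1) by (auto simp: eigendecomposition_def)
  note ctxt = inv assms(2,3)
  have p: "p j = argmax_by sel (\<lambda>r. norm (column j T $ r))" for j
    using assms(3) unfolding gauss_elimination_def by blast
  {
    fix \<Phi> v j
    assume run: "greedy_run sel L M \<Phi> v"
      and "card {..<j} < M \<and> (\<forall>i\<le>j. \<forall>i'>i. norm (lam i) < norm (lam i'))"
    then show "\<exists>c. c \<noteq> 0 \<and> column j T = c *s cvec (column j \<Phi>)"
    proof (induction j rule: finite_linorder_less_induct)
      case (1 j)
      let ?f = "column j \<Phi>" and ?A = "- (p ` {..<j})"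
      have gap: "norm (lam i) < norm (lam i')" if "i \<le> j" "i < i'" for i i'
        using 1(3) that by blast
      have "v i = p i" if "i < j" for i
      proof -
        have "card {..<i} \<le> card {..<j}"
          using that by (intro card_mono) auto
        then have "card {..<i} < M"
          using 1(3) by simp
        moreover have "\<forall>k\<le>i. \<forall>k'>k. norm (lam k) < norm (lam k')"
          using gap that by auto
        ultimately have "\<exists>c. c \<noteq> 0 \<and> column i T = c *s cvec (column i \<Phi>)"
          by (intro 1(1)[OF that run] conjI)
        then obtain c where "c \<noteq> 0" "column i T = c *s cvec (column i \<Phi>)"
          by blast
        with \<open>card {..<i} < M\<close> show ?thesis
          using run argmax_by_scaled_cvec[of "column i T" c "column i \<Phi>" sel]
          by (simp add: greedy_run_def p)
      qed
      then have "v ` {..<j} = p ` {..<j}"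
        by (auto simp: image_iff)
      moreover have "smoothest_signal L (- (v ` {..<j})) ?f"
        using run 1(3) by (simp add: greedy_run_def)
      ultimately have "smoothest_signal L ?A ?f"
        by simp
      then have f: "?f \<in> L2 ?A" "?f \<noteq> 0"
        and min: "\<And>g. g \<in> L2 ?A \<Longrightarrow> g \<noteq> 0 \<Longrightarrow> bandwidth lam U ?f \<le> bandwidth lam U g"
        by (auto simp: smoothest_signal_iff[OF assms(1)])
      have "\<exists>c. (\<chi> r. cnj (U $ r $ k)) = c *s column k U" if "k \<le> j" for k
      proof (rule cnj_eigenvector_simple_modulus[OF assms(1)])
        show "norm (lam i) \<noteq> norm (lam k)" if "i \<noteq> k" for i
          using gap[of i k] gap[of k i] that \<open>k \<le> j\<close> order_trans[of i k j]
          by (cases i k rule: linorder_cases) auto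
      qed
      then obtain c g where "c \<noteq> 0" "column j T = c *s cvec g"
        using elimination_column_real_multiple[OF ctxt, of j] by blast
      note g = elimination_column_signal[OF ctxt mono this]
      have "bandwidth lam U ?f \<le> norm (lam j)"
        using min[OF g(1,2)] g(3) by simp
      then have "norm (lam k) \<le> norm (lam j)" if "gft U ?f $ k \<noteq> 0" for k
        using that by (simp add: bandwidth_le_iff[OF inv f(2)])
      then have z: "gft U ?f $ k = 0" if "k > j" for k
        using gap[OF order_refl that] by fastforce
      have "U *v gft U ?f = gft U ?f $ j *s column j T"
      proof (rule elimination_column_unique[OF ctxt z])
        show "(U *v gft U ?f) $ p i = 0" if "i < j" for i
          using f(1) that unfolding cvec_eq_mult_gft[OF inv, symmetric]
          by (simp add: cvec_def L2_def)
      qed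
      then have cf: "cvec ?f = gft U ?f $ j *s column j T"
        by (simp flip: cvec_eq_mult_gft[OF inv])
      then have nz: "gft U ?f $ j \<noteq> 0"
        using f(2) cvec_eq_0_iff[of ?f] by auto
      then have "column j T = inverse (gft U ?f $ j) *s cvec ?f"
        by (simp add: cf vector_smult_assoc)
      with nz show ?case
        by (intro exI[of _ "inverse (gft U ?f $ j)"]) simp
    qed
  }
  assume real: "\<forall>i j. U $ i $ j \<in> \<real>"
  have "\<exists>c g. c \<noteq> 0 \<and> column j T = c *s cvec g" for j
  proof -
    have "(\<chi> r. cnj (U $ r $ k)) = 1 *s column k U" for k
      using real by (simp add: vec_eq_iff column_def Reals_cnj_iff)
    then show ?thesis
      using elimination_column_real_multiple[OF ctxt, of j] by blast
  qed
  then obtain c g where cg: "\<And>j. c j \<noteq> 0" "\<And>j. column j T = c j *s cvec (g j)"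
    by metis
  define \<Phi> where "\<Phi> = (\<chi> r j. g j $ r)"
  have col: "column j \<Phi> = g j" for j
    by (simp add: \<Phi>_def column_def vec_eq_iff)
  have "smoothest_signal L (- (p ` {..<j})) (g j)" for j
    using elimination_column_signal[OF ctxt mono cg, of j] bandwidth_ge_elimination[OF ctxt mono]
    by (simp add: smoothest_signal_iff[OF assms(1)])
  then have "greedy_run sel L M \<Phi> p"
    using argmax_by_scaled_cvec[OF cg(2,1)] by (simp add: greedy_run_def col p)
  then show "\<exists>\<Phi> v. greedy_run sel L M \<Phi> v \<and>
      (\<forall>j. card {..<j} < M \<longrightarrow> (\<exists>c. c \<noteq> 0 \<and> column j T = c *s cvec (column j \<Phi>)))"
    using cg unfolding col[symmetric] by blast
qed

end
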